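(* Let $(\mathfrak g,\diamond)$ be a Novikov algebra over $\mathbb K$. (i) A bilinear map $\omega\in\mathrm{Hom}(\mathfrak g\otimes\mathfrak g,\mathfrak g)$ generates an infinitesimal deformation of $\mathfrak g$ if and only if $\omega$ is a $2$-cocycle of $\mathfrak g$ (in the Novikov cochain complex of $\mathfrak g$ with coefficients in $\mathfrak g$). (ii) Two infinitesimal deformations $(\mathbb K[t]/(t^2)\otimes\mathfrak g,\diamond_t)$ and $(\mathbb K[t]/(t^2)\otimes\mathfrak g,\diamond'_t)$ of $(\mathfrak g,\diamond)$, generated by $\omega$ and $\omega'$ respectively, are equivalent if and only if $\omega$ and $\omega'$ are in the same cohomology class in $\mathcal H^2_{\mathrm{Nov}}(\mathfrak g;\mathfrak g)$.
   Context: $\mathbb K$ is a field of characteristic $0$. A (left) Novikov algebra is a vector space $\mathfrak g$ with a bilinear operation $\diamond$ satisfying $(x\diamond y)\diamond z-x\diamond(y\diamond z)=(y\diamond x)\diamond z-y\diamond(x\diamond z)$ and $(x\diamond y)\diamond z=(x\diamond z)\diamond y$. $\omega\in\mathrm{Hom}(\mathfrak g\otimes\mathfrak g,\mathfrak g)$ generates an infinitesimal deformation of $(\mathfrak g,\diamond)$ if the operation on $\mathbb K[t]/(t^2)\otimes\mathfrak g$ given by $x\diamond_ty=x\diamond y+t\,\omega(x,y)$ for $x,y\in\mathfrak g$ (extended $\mathbb K[t]/(t^2)$-bilinearly) makes it a Novikov algebra. Two infinitesimal deformations $\diamond_t,\diamond'_t$ (generated by $\omega,\omega'$) are equivalent if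 there is a linear map $N\in\mathrm{End}(\mathfrak g)$ such that $\mathrm{id}+tN$ (extended $\mathbb K[t]/(t^2)$-linearly) is a homomorphism of Novikov algebras from $(\mathbb K[t]/(t^2)\otimes\mathfrak g,\diamond_t)$ to $(\mathbb K[t]/(t^2)\otimes\mathfrak g,\diamond'_t)$. Low-degree part of the Novikov cochain complex: $\mathfrak C^1=\mathrm{Hom}(\mathfrak g,\mathfrak g)$, $\mathfrak C^2=\mathrm{Hom}(\mathfrak g\otimes\mathfrak g,\mathfrak g)$, $\mathfrak C^3=\mathrm{Hom}(\mathfrak g\otimes\wedge^2\mathfrak g,\mathfrak g)\oplus\mathrm{Hom}(\wedge^2\mathfrak g\otimes\mathfrak g,\mathfrak g)$, with $d^1(N)(x,y)=N(x)\diamond y+x\diamond N(y)-N(x\diamond y)$ and $d^2(f)=(d^{(1,1)}_{(1,0,2)}f,\ d^{(1,1)}_{(0,2,1)}f)$, where $$(d^{(1,1)}_{(1,0,2)}f)(x_1;x_2,x_3)=f(x_1,x_3)\diamond x_2-f(x_1,x_2)\diamond x_3-f(x_1\diamond x_2,x_3)+f(x_1\diamond x_3,x_2),$$ $$\begin{aligned}(d^{(1,1)}_{(0,2,1)}f)(x_1,x_2;x_3)={}&x_1\diamond f(x_2,x_3)-x_2\diamond f(x_1,x_3)-f(x_1,x_2)\diamond x_3+f(x_2,x_1)\diamond x_3\\&-f(x_1\diamond x_2,x_3)+f(x_2\diamond x_1,x_3)-f(x_2,x_1\diamond x_3)+f(x_1,x_2\diamond x_3).\end{aligned}$$ A $2$-cocycle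 is an element of $\ker d^2$, and $\mathcal H^2_{\mathrm{Nov}}(\mathfrak g;\mathfrak g)=\ker d^2/\operatorname{im}d^1$. *)

theory Defs
  imports
    "HOL-Computational_Algebra.Polynomial"
    "HOL-Library.Function_Algebras"
    "HOL-Library.Product_Plus"
    "HOL-Library.Set_Algebras"
begin

section \<open>Novikov algebras over a commutative ring\<close>

text \<open>
  Over a field, \<^locale>\<open>module\<close> is the same as \<^locale>\<open>vector_space\<close>. The ground ring is
  arbitrary because the notion is needed both over $K$ and over $K[t]/(t^2)$.
\<close>

definition bilinear_map ::
    "('r::comm_ring_1 \<Rightarrow> 'a::ab_group_add \<Rightarrow> 'a) \<Rightarrow> ('r \<Rightarrow> 'b::ab_group_add \<Rightarrow> 'b) \<Rightarrow>
     ('r \<Rightarrow> 'c::ab_group_add \<Rightarrow> 'c) \<Rightarrow> ('a \<Rightarrow> 'b \<Rightarrow> 'c) \<Rightarrow> bool" where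
  "bilinear_map s1 s2 s3 f \<longleftrightarrow>
     (\<forall>x. module_hom s2 s3 (f x)) \<and> (\<forall>y. module_hom s1 s3 (\<lambda>x. f x y))"

locale novikov_algebra = module scale
  for scale :: "'r::comm_ring_1 \<Rightarrow> 'm::ab_group_add \<Rightarrow> 'm" +
  fixes nprod :: "'m \<Rightarrow> 'm \<Rightarrow> 'm" (infixl \<open>\<diamondop>\<close> 70)
  assumes bilinear: "bilinear_map scale scale scale nprod"
    and left_symmetric: "(x \<diamondop> y) \<diamondop> z - x \<diamondop> (y \<diamondop> z) = (y \<diamondop> x) \<diamondop> z - y \<diamondop> (x \<diamondop> z)"
    and right_commutative: "(x \<diamondop> y) \<diamondop> z = (x \<diamondop> z) \<diamondop> y"

definition novikov_hom ::
    "('r::comm_ring_1 \<Rightarrow> 'm::ab_group_add \<Rightarrow> 'm) \<Rightarrow> ('m \<Rightarrow> 'm \<Rightarrow> 'm) \<Rightarrow>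
     ('r \<Rightarrow> 'n::ab_group_add \<Rightarrow> 'n) \<Rightarrow> ('n \<Rightarrow> 'n \<Rightarrow> 'n) \<Rightarrow> ('m \<Rightarrow> 'n) \<Rightarrow> bool" where
  "novikov_hom s1 p1 s2 p2 \<phi> \<longleftrightarrow>
     novikov_algebra s1 p1 \<and> novikov_algebra s2 p2 \<and>
     module_hom s1 s2 \<phi> \<and> (\<forall>x y. \<phi> (p1 x y) = p2 (\<phi> x) (\<phi> y))"


section \<open>The ring $K[t]/(t^2)$\<close>

lemma t_square_dvd_iff:
  "monom (1::'a::comm_ring_1) 2 dvd p \<longleftrightarrow> coeff p 0 = 0 \<and> coeff p 1 = 0"
  by (auto simp: monom_1_dvd_iff' numeral_2_eq_2 less_Suc_eq)

quotient_type (overloaded) 'a dual_number =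
  "'a::comm_ring_1 poly" / "\<lambda>p q. monom 1 2 dvd p - q"
  by (intro equivpI reflpI sympI transpI) (auto simp: t_square_dvd_iff)

instantiation dual_number :: (comm_ring_1) comm_ring_1
begin

lift_definition zero_dual_number :: "'a dual_number" is 0 .
lift_definition one_dual_number :: "'a dual_number" is 1 .
lift_definition plus_dual_number :: "'a dual_number \<Rightarrow> 'a dual_number \<Rightarrow> 'a dual_number" is "(+)"
  by (simp add: t_square_dvd_iff)
lift_definition minus_dual_number :: "'a dual_number \<Rightarrow> 'a dual_number \<Rightarrow> 'a dual_number" is "(-)"
  by (simp add: t_square_dvd_iff)
lift_definition uminus_dual_number :: "'a dual_number \<Rightarrow> 'a dual_number" is uminus
  by (simp add: t_square_dvd_iff)
lift_definition times_dual_number :: "'a dual_number \<Rightarrow> 'a dual_number \<Rightarrow> 'a dual_number" is "(*)"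
  by (simp add: t_square_dvd_iff coeff_mult)

instance
  by standard (transfer; simp add: algebra_simps t_square_dvd_iff)+

end

lift_definition dn_const :: "'a::comm_ring_1 \<Rightarrow> 'a dual_number" is "\<lambda>a. [:a:]" .

lift_definition dn_t :: "'a::comm_ring_1 dual_number" is "monom 1 1" .


section \<open>The module $K[t]/(t^2) \otimes \mathfrak g$\<close>

text \<open>
  The tensor product over $K$ is realised on \<open>'g \<times> 'g\<close>, the pair \<open>(x, y)\<close> standing for
  $1 \otimes x + t \otimes y$. The universal property is \<open>dn_tensor_universal\<close> below; the
  formulas for \<open>deformed_prod\<close> and \<open>id_plus_t\<close> are obtained by extending
  $x \diamond_t y = x \diamond y + t\,\omega(x,y)$ and $x \mapsto x + t\,N(x)$ from
  $\mathfrak g$, see \<open>deformed_prod_extension\<close> and \<open>id_plus_t_extension\<close>.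
\<close>

lift_definition dn_scale ::
    "('k::comm_ring_1 \<Rightarrow> 'g::ab_group_add \<Rightarrow> 'g) \<Rightarrow> 'k dual_number \<Rightarrow> 'g \<times> 'g \<Rightarrow> 'g \<times> 'g"
  is "\<lambda>scale p (x, y). (scale (coeff p 0) x, scale (coeff p 0) y + scale (coeff p 1) x)"
  by (auto simp: t_square_dvd_iff fun_eq_iff)

definition dn_tensor ::
    "('k::comm_ring_1 \<Rightarrow> 'g::ab_group_add \<Rightarrow> 'g) \<Rightarrow> 'k dual_number \<Rightarrow> 'g \<Rightarrow> 'g \<times> 'g" where
  "dn_tensor scale p x = dn_scale scale p (x, 0)"

definition deformed_prod ::
    "('g::ab_group_add \<Rightarrow> 'g \<Rightarrow> 'g) \<Rightarrow> ('g \<Rightarrow> 'g \<Rightarrow> 'g) \<Rightarrow> 'g \<times> 'g \<Rightarrow> 'g \<times> 'g \<Rightarrow> 'g \<times> 'g" where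
  "deformed_prod nprod \<omega> =
     (\<lambda>(x0, x1) (y0, y1). (nprod x0 y0, nprod x0 y1 + nprod x1 y0 + \<omega> x0 y0))"

definition id_plus_t :: "('g::ab_group_add \<Rightarrow> 'g) \<Rightarrow> 'g \<times> 'g \<Rightarrow> 'g \<times> 'g" where
  "id_plus_t N = (\<lambda>(x0, x1). (x0, x1 + N x0))"


section \<open>Low degree Novikov cochains\<close>

definition cochains1 :: "('k::field \<Rightarrow> 'g::ab_group_add \<Rightarrow> 'g) \<Rightarrow> ('g \<Rightarrow> 'g) set" where
  "cochains1 scale = {N. module_hom scale scale N}"

definition cochains2 :: "('k::field \<Rightarrow> 'g::ab_group_add \<Rightarrow> 'g) \<Rightarrow> ('g \<Rightarrow> 'g \<Rightarrow> 'g) set" where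
  "cochains2 scale = {f. bilinear_map scale scale scale f}"

text \<open>
  Maps on $\wedge^2\mathfrak g$ are represented by alternating maps: the first component alternates
  in its last two arguments, the second one in its first two.
\<close>

definition cochains3 ::
    "('k::field \<Rightarrow> 'g::ab_group_add \<Rightarrow> 'g) \<Rightarrow>
     (('g \<Rightarrow> 'g \<Rightarrow> 'g \<Rightarrow> 'g) \<times> ('g \<Rightarrow> 'g \<Rightarrow> 'g \<Rightarrow> 'g)) set" where
  "cochains3 scale =
     (let trilinear = (\<lambda>f. (\<forall>x. bilinear_map scale scale scale (f x)) \<and>
                           (\<forall>y z. module_hom scale scale (\<lambda>x. f x y z)))
      in {f. trilinear f \<and> (\<forall>x y. f x y y = 0)} \<times> {f. trilinear f \<and> (\<forall>x y. f x x y = 0)})"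

definition d1 :: "('g::ab_group_add \<Rightarrow> 'g \<Rightarrow> 'g) \<Rightarrow> ('g \<Rightarrow> 'g) \<Rightarrow> 'g \<Rightarrow> 'g \<Rightarrow> 'g" where
  "d1 nprod N = (\<lambda>x y. nprod (N x) y + nprod x (N y) - N (nprod x y))"

definition d2_102 ::
    "('g::ab_group_add \<Rightarrow> 'g \<Rightarrow> 'g) \<Rightarrow> ('g \<Rightarrow> 'g \<Rightarrow> 'g) \<Rightarrow> 'g \<Rightarrow> 'g \<Rightarrow> 'g \<Rightarrow> 'g" where
  "d2_102 nprod f = (\<lambda>x1 x2 x3.
     nprod (f x1 x3) x2 - nprod (f x1 x2) x3 - f (nprod x1 x2) x3 + f (nprod x1 x3) x2)"

definition d2_021 ::
    "('g::ab_group_add \<Rightarrow> 'g \<Rightarrow> 'g) \<Rightarrow> ('g \<Rightarrow> 'g \<Rightarrow> 'g) \<Rightarrow> 'g \<Rightarrow> 'g \<Rightarrow> 'g \<Rightarrow> 'g" where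
  "d2_021 nprod f = (\<lambda>x1 x2 x3.
     nprod x1 (f x2 x3) - nprod x2 (f x1 x3) - nprod (f x1 x2) x3 + nprod (f x2 x1) x3
     - f (nprod x1 x2) x3 + f (nprod x2 x1) x3 - f x2 (nprod x1 x3) + f x1 (nprod x2 x3))"

definition d2 ::
    "('g::ab_group_add \<Rightarrow> 'g \<Rightarrow> 'g) \<Rightarrow> ('g \<Rightarrow> 'g \<Rightarrow> 'g) \<Rightarrow>
     ('g \<Rightarrow> 'g \<Rightarrow> 'g \<Rightarrow> 'g) \<times> ('g \<Rightarrow> 'g \<Rightarrow> 'g \<Rightarrow> 'g)" where
  "d2 nprod f = (d2_102 nprod f, d2_021 nprod f)"

definition cocycles2 ::
    "('k::field \<Rightarrow> 'g::ab_group_add \<Rightarrow> 'g) \<Rightarrow> ('g \<Rightarrow> 'g \<Rightarrow> 'g) \<Rightarrow> ('g \<Rightarrow> 'g \<Rightarrow> 'g) set" where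
  "cocycles2 scale nprod = {f \<in> cochains2 scale. d2 nprod f = 0}"

definition coboundaries2 ::
    "('k::field \<Rightarrow> 'g::ab_group_add \<Rightarrow> 'g) \<Rightarrow> ('g \<Rightarrow> 'g \<Rightarrow> 'g) \<Rightarrow> ('g \<Rightarrow> 'g \<Rightarrow> 'g) set" where
  "coboundaries2 scale nprod = d1 nprod ` cochains1 scale"

definition cohomology_class ::
    "('k::field \<Rightarrow> 'g::ab_group_add \<Rightarrow> 'g) \<Rightarrow> ('g \<Rightarrow> 'g \<Rightarrow> 'g) \<Rightarrow>
     ('g \<Rightarrow> 'g \<Rightarrow> 'g) \<Rightarrow> ('g \<Rightarrow> 'g \<Rightarrow> 'g) set" where
  "cohomology_class scale nprod f = f +o coboundaries2 scale nprod"

definition H2_Nov ::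
    "('k::field \<Rightarrow> 'g::ab_group_add \<Rightarrow> 'g) \<Rightarrow> ('g \<Rightarrow> 'g \<Rightarrow> 'g) \<Rightarrow> ('g \<Rightarrow> 'g \<Rightarrow> 'g) set set" where
  "H2_Nov scale nprod = cohomology_class scale nprod ` cocycles2 scale nprod"


section \<open>Infinitesimal deformations\<close>

definition generates_infinitesimal_deformation ::
    "('k::field \<Rightarrow> 'g::ab_group_add \<Rightarrow> 'g) \<Rightarrow> ('g \<Rightarrow> 'g \<Rightarrow> 'g) \<Rightarrow> ('g \<Rightarrow> 'g \<Rightarrow> 'g) \<Rightarrow> bool" where
  "generates_infinitesimal_deformation scale nprod \<omega> \<longleftrightarrow>
     \<omega> \<in> cochains2 scale \<and> novikov_algebra (dn_scale scale) (deformed_prod nprod \<omega>)"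

text \<open>Both arguments are meant to generate infinitesimal deformations.\<close>

definition equivalent_deformations ::
    "('k::field \<Rightarrow> 'g::ab_group_add \<Rightarrow> 'g) \<Rightarrow> ('g \<Rightarrow> 'g \<Rightarrow> 'g) \<Rightarrow>
     ('g \<Rightarrow> 'g \<Rightarrow> 'g) \<Rightarrow> ('g \<Rightarrow> 'g \<Rightarrow> 'g) \<Rightarrow> bool" where
  "equivalent_deformations scale nprod \<omega> \<omega>' \<longleftrightarrow>
     (\<exists>N \<in> cochains1 scale.
        novikov_hom (dn_scale scale) (deformed_prod nprod \<omega>)
                    (dn_scale scale) (deformed_prod nprod \<omega>') (id_plus_t N))"


section \<open>The concrete descriptions agree with the intended objects\<close>

lemma dn_scale_const: "dn_scale scale (dn_const a) (x, y) = (scale a x, scale a y + scale 0 x)"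
  by transfer simp

lemma dn_scale_t: "dn_scale scale dn_t (x, y) = (scale 0 x, scale 0 y + scale 1 x)"
  by transfer simp

lemma dn_decompose: "\<exists>a b. p = dn_const a + dn_t * dn_const b"
proof (transfer)
  fix p :: "'a poly"
  have "monom 1 2 dvd p - ([:coeff p 0:] + monom 1 1 * [:coeff p 1:])"
    unfolding t_square_dvd_iff by (simp add: coeff_mult)
  then show "\<exists>a b. monom 1 2 dvd p - ([:a:] + monom 1 1 * [:b:])" by blast
qed

lemma dn_scale_decomposed:
  "dn_scale scale (dn_const a + dn_t * dn_const b) (x, y) = (scale a x, scale a y + scale b x)"
  by (simp add: dn_const.abs_eq dn_t.abs_eq times_dual_number.abs_eq plus_dual_number.abs_eq
      dn_scale.abs_eq coeff_mult)

lemma module_dn_scale: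
  assumes "module scale"
  shows "module (dn_scale scale)"
proof -
  interpret module scale by fact
  show ?thesis
  proof
    fix a b :: "'a dual_number" and x y :: "'b \<times> 'b"
    obtain a0 a1 b0 b1 where a: "a = dn_const a0 + dn_t * dn_const a1"
      and b: "b = dn_const b0 + dn_t * dn_const b1"
      using dn_decompose by metis
    obtain x0 x1 y0 y1 where x: "x = (x0, x1)" and y: "y = (y0, y1)"
      by (cases x, cases y) blast
    have "a + b = dn_const (a0 + b0) + dn_t * dn_const (a1 + b1)"
      unfolding a b by transfer (simp add: t_square_dvd_iff coeff_mult)
    then show "dn_scale scale (a + b) x = dn_scale scale a x + dn_scale scale b x"
      by (simp only: dn_scale_decomposed x a b) (simp add: scale_left_distrib ac_simps)
    have "a * b = dn_const (a0 * b0) + dn_t * dn_const (a0 * b1 + a1 * b0)"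
      unfolding a b by transfer (simp add: t_square_dvd_iff coeff_mult)
    then show "dn_scale scale a (dn_scale scale b x) = dn_scale scale (a * b) x"
      by (simp only: dn_scale_decomposed x a b)
        (simp add: scale_left_distrib scale_right_distrib ac_simps)
    show "dn_scale scale a (x + y) = dn_scale scale a x + dn_scale scale a y"
      by (simp add: dn_scale_decomposed x y a scale_right_distrib ac_simps)
    have "(1 :: 'a dual_number) = dn_const 1 + dn_t * dn_const 0"
      by transfer (simp add: t_square_dvd_iff coeff_mult)
    then have "dn_scale scale 1 x = dn_scale scale (dn_const 1 + dn_t * dn_const 0) x" by simp
    also have "\<dots> = x" by (simp add: x dn_scale_decomposed)
    finally show "dn_scale scale 1 x = x" .
  qed
qed

lemma dn_tensor_split:
  assumes "module scale"
  shows "(x, y) = dn_tensor scale 1 x + dn_tensor scale dn_t y"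
proof -
  interpret module scale by fact
  interpret D: module "dn_scale scale" by (rule module_dn_scale) fact
  show ?thesis by (simp add: dn_tensor_def dn_scale_t)
qed

text \<open>Universal property of the tensor product of $K$-modules.\<close>

lemma dn_tensor_bilinear:
  assumes "module scale"
  shows "bilinear_map (\<lambda>c p. dn_const c * p) scale (\<lambda>c. dn_scale scale (dn_const c)) (dn_tensor scale)"
proof -
  interpret module scale by fact
  interpret D: module "dn_scale scale" by (rule module_dn_scale) fact
  have c1: "dn_const (a + b) = dn_const a + dn_const b" for a b :: 'a
    by transfer (simp add: t_square_dvd_iff)
  have c2: "dn_const (a * b) = dn_const a * dn_const b" for a b :: 'a
    by transfer (simp add: t_square_dvd_iff)
  have c3: "dn_const (1 :: 'a) = 1"
    by transfer (simp add: t_square_dvd_iff)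
  have K: "module (\<lambda>c p. dn_const c * p :: 'a dual_number)"
    by standard (simp_all only: c1 c2 c3 distrib_left distrib_right mult.assoc mult_1)
  have M: "module (\<lambda>c. dn_scale scale (dn_const c))"
    by standard (simp_all only: c1 c2 c3 D.scale_left_distrib D.scale_right_distrib
        D.scale_scale D.scale_one)
  have lin: "dn_scale scale p (scale a x, 0) = dn_scale scale (dn_const a) (dn_scale scale p (x, 0))"
    and add: "dn_scale scale p (x + y, 0) = dn_scale scale p (x, 0) + dn_scale scale p (y, 0)"
    for p a x y
  proof -
    obtain p0 p1 where p: "p = dn_const p0 + dn_t * dn_const p1" using dn_decompose by blast
    show "dn_scale scale p (scale a x, 0) = dn_scale scale (dn_const a) (dn_scale scale p (x, 0))"
      and "dn_scale scale p (x + y, 0) = dn_scale scale p (x, 0) + dn_scale scale p (y, 0)"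
      by (simp_all add: p dn_scale_decomposed dn_scale_const scale_right_distrib ac_simps)
  qed
  show ?thesis
    unfolding bilinear_map_def module_hom_iff
    by (simp add: K M module_axioms dn_tensor_def lin add D.scale_left_distrib)
qed

lemma dn_tensor_universal:
  fixes scale :: "'k::comm_ring_1 \<Rightarrow> 'g::ab_group_add \<Rightarrow> 'g"
    and sW :: "'k \<Rightarrow> 'w::ab_group_add \<Rightarrow> 'w"
  assumes "module scale" and B: "bilinear_map (\<lambda>c p. dn_const c * p) scale sW B"
  shows "\<exists>!F. module_hom (\<lambda>c. dn_scale scale (dn_const c)) sW F \<and>
              (\<forall>p x. F (dn_tensor scale p x) = B p x)"
proof -
  interpret module scale by fact
  interpret D: module "dn_scale scale" by (rule module_dn_scale) fact
  have T: "module (\<lambda>c. dn_scale scale (dn_const c))"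
    using dn_tensor_bilinear[OF \<open>module scale\<close>] by (simp add: bilinear_map_def module_hom_iff)
  have W: "module sW" using B by (simp add: bilinear_map_def module_hom_iff)
  interpret W: module sW by fact
  have Br: "B p (x + y) = B p x + B p y" "B p (scale a x) = sW a (B p x)"
    and Bl: "B (p + q) x = B p x + B q x" "B (dn_const a * p) x = sW a (B p x)" for p q x y a
    using B by (auto simp: bilinear_map_def module_hom_iff)
  have B0: "B p 0 = 0" for p using Br(1)[of p 0 0] by simp
  define F where "F = (\<lambda>(x, y). B 1 x + B dn_t y)"
  have hom: "module_hom (\<lambda>c. dn_scale scale (dn_const c)) sW F"
    unfolding module_hom_iff
    by (auto simp: T W F_def dn_scale_const Br W.scale_right_distrib)
  have val: "F (dn_tensor scale p x) = B p x" for p x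
  proof -
    obtain a b where p: "p = dn_const a + dn_t * dn_const b" using dn_decompose by blast
    have "dn_tensor scale p x = (scale a x, scale b x)"
      by (simp add: p dn_tensor_def dn_scale_decomposed)
    moreover have "B p x = sW a (B 1 x) + sW b (B dn_t x)"
      unfolding p using Bl(2)[of a 1 x] Bl(2)[of b dn_t x] by (simp add: Bl(1) mult.commute)
    ultimately show ?thesis by (simp add: F_def Br)
  qed
  show ?thesis
  proof (rule ex1I[of _ F])
    fix G assume G: "module_hom (\<lambda>c. dn_scale scale (dn_const c)) sW G \<and>
              (\<forall>p x. G (dn_tensor scale p x) = B p x)"
    show "G = F"
    proof
      fix v :: "'g \<times> 'g"
      obtain x y where v: "v = (x, y)" by force
      have "G (dn_tensor scale 1 x + dn_tensor scale dn_t y) = B 1 x + B dn_t y"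
        using G by (simp only: module_hom.add[OF conjunct1[OF G]])
      then show "G v = F v"
        unfolding dn_tensor_split[OF \<open>module scale\<close>, of x y, symmetric] by (simp add: v F_def)
    qed
  qed (intro conjI allI hom val)
qed

text \<open>
  \<^const>\<open>deformed_prod\<close> is the unique $K[t]/(t^2)$-bilinear extension of
  $x \diamond_t y = x \diamond y + t\,\omega(x,y)$, and \<^const>\<open>id_plus_t\<close> is the unique
  $K[t]/(t^2)$-linear extension of $x \mapsto x + t\,N(x)$.
\<close>

lemma deformed_prod_extension:
  fixes scale :: "'k::comm_ring_1 \<Rightarrow> 'g::ab_group_add \<Rightarrow> 'g" and nprod \<omega> :: "'g \<Rightarrow> 'g \<Rightarrow> 'g"
  assumes "bilinear_map scale scale scale nprod" "bilinear_map scale scale scale \<omega>"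
  shows "bilinear_map (dn_scale scale) (dn_scale scale) (dn_scale scale) P \<and>
         (\<forall>x y. P (dn_tensor scale 1 x) (dn_tensor scale 1 y) =
            dn_tensor scale 1 (nprod x y) + dn_scale scale dn_t (dn_tensor scale 1 (\<omega> x y)))
         \<longleftrightarrow> P = deformed_prod nprod \<omega>"
proof -
  have "module scale" using assms by (simp add: bilinear_map_def module_hom_iff)
  then interpret module scale .
  interpret D: module "dn_scale scale" by (rule module_dn_scale) fact
  have r: "nprod x (y + z) = nprod x y + nprod x z" "nprod (y + z) x = nprod y x + nprod z x"
    "nprod x (scale a y) = scale a (nprod x y)" "nprod (scale a x) y = scale a (nprod x y)"
    "\<omega> x (y + z) = \<omega> x y + \<omega> x z" "\<omega> (y + z) x = \<omega> y x + \<omega> z x"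
    "\<omega> x (scale a y) = scale a (\<omega> x y)" "\<omega> (scale a x) y = scale a (\<omega> x y)"
    for x y z a
    using assms by (auto simp: bilinear_map_def module_hom_iff)
  have z: "nprod x 0 = 0" "nprod 0 x = 0" "\<omega> x 0 = 0" "\<omega> 0 x = 0" for x
    using r(1)[of x 0 0] r(2)[of 0 0 x] r(5)[of x 0 0] r(6)[of 0 0 x] by simp_all
  have 1: "deformed_prod nprod \<omega> x (dn_scale scale a y) = dn_scale scale a (deformed_prod nprod \<omega> x y)"
          "deformed_prod nprod \<omega> (dn_scale scale a y) x = dn_scale scale a (deformed_prod nprod \<omega> y x)"
    for x y a
  proof -
    obtain p q where a: "a = dn_const p + dn_t * dn_const q" using dn_decompose by blast
    obtain x0 x1 y0 y1 where xy: "x = (x0, x1)" "y = (y0, y1)" by force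
    show "deformed_prod nprod \<omega> x (dn_scale scale a y) = dn_scale scale a (deformed_prod nprod \<omega> x y)"
      and "deformed_prod nprod \<omega> (dn_scale scale a y) x = dn_scale scale a (deformed_prod nprod \<omega> y x)"
      by (simp_all add: a xy dn_scale_decomposed deformed_prod_def r scale_right_distrib ac_simps)
  qed
  have bil: "bilinear_map (dn_scale scale) (dn_scale scale) (dn_scale scale) (deformed_prod nprod \<omega>)"
    unfolding bilinear_map_def module_hom_iff
    by (auto simp: D.module_axioms 1) (auto simp: deformed_prod_def r)
  have i: "dn_tensor scale 1 x = (x, 0)" for x by (simp add: dn_tensor_def)
  have val: "deformed_prod nprod \<omega> (x, 0) (y, 0) =
    dn_tensor scale 1 (nprod x y) + dn_scale scale dn_t (dn_tensor scale 1 (\<omega> x y))" for x y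
    by (simp add: deformed_prod_def i dn_scale_t z)
  have uniq: "P = deformed_prod nprod \<omega>"
    if bP: "bilinear_map (dn_scale scale) (dn_scale scale) (dn_scale scale) P"
      and vP: "\<forall>x y. P (x, 0) (y, 0) = deformed_prod nprod \<omega> (x, 0) (y, 0)"
  proof (intro ext)
    fix v w :: "'g \<times> 'g"
    obtain x0 x1 y0 y1 where vw: "v = (x0, x1)" "w = (y0, y1)" by force
    have s: "(x, y) = (x, 0) + dn_scale scale dn_t (y, 0)" for x y
      by (simp add: dn_scale_t)
    have "Q v w = Q (x0, 0) (y0, 0) + dn_scale scale dn_t (Q (x0, 0) (y1, 0)) +
        dn_scale scale dn_t (Q (x1, 0) (y0, 0)) +
        dn_scale scale dn_t (dn_scale scale dn_t (Q (x1, 0) (y1, 0)))"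
      if "bilinear_map (dn_scale scale) (dn_scale scale) (dn_scale scale) Q" for Q
    proof -
      have q: "Q x (y + z) = Q x y + Q x z" "Q (y + z) x = Q y x + Q z x"
        "Q x (dn_scale scale a y) = dn_scale scale a (Q x y)"
        "Q (dn_scale scale a x) y = dn_scale scale a (Q x y)" for x y z a
        using that unfolding bilinear_map_def module_hom_iff by blast+
      show ?thesis
        unfolding vw by (subst s[of x0 x1], subst s[of y0 y1])
          (simp only: q D.scale_right_distrib add.assoc add.commute add.left_commute)
    qed
    from this[OF bP] this[OF bil] show "P v w = deformed_prod nprod \<omega> v w"
      using vP by simp
  qed
  show ?thesis unfolding val[symmetric] unfolding i using bil uniq by blast
qed

lemma id_plus_t_extension:
  fixes scale :: "'k::comm_ring_1 \<Rightarrow> 'g::ab_group_add \<Rightarrow> 'g" and N :: "'g \<Rightarrow> 'g"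
  assumes "module_hom scale scale N"
  shows "module_hom (dn_scale scale) (dn_scale scale) F \<and>
         (\<forall>x. F (dn_tensor scale 1 x) =
            dn_tensor scale 1 x + dn_scale scale dn_t (dn_tensor scale 1 (N x)))
         \<longleftrightarrow> F = id_plus_t N"
proof -
  interpret N: module_hom scale scale N by fact
  interpret D: module "dn_scale scale" by (rule module_dn_scale) (rule N.m1.module_axioms)
  have 1: "id_plus_t N (dn_scale scale a x) = dn_scale scale a (id_plus_t N x)" for a x
  proof -
    obtain p q where a: "a = dn_const p + dn_t * dn_const q" using dn_decompose by blast
    obtain x0 x1 where x: "x = (x0, x1)" by force
    show ?thesis
      by (simp add: a x dn_scale_decomposed id_plus_t_def N.add N.scale N.m1.scale_right_distrib ac_simps)
  qed
  have hom: "module_hom (dn_scale scale) (dn_scale scale) (id_plus_t N)"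
    unfolding module_hom_iff by (auto simp: D.module_axioms 1) (auto simp: id_plus_t_def N.add)
  have i: "dn_tensor scale 1 x = (x, 0)" for x by (simp add: dn_tensor_def)
  have val: "id_plus_t N (x, 0) = (x, 0) + dn_scale scale dn_t (N x, 0)" for x
    by (simp add: id_plus_t_def dn_scale_t)
  have uniq: "F = id_plus_t N"
    if F: "module_hom (dn_scale scale) (dn_scale scale) F"
      and v: "\<forall>x. F (x, 0) = id_plus_t N (x, 0)"
  proof
    fix u :: "'g \<times> 'g"
    obtain x y where u: "u = (x, y)" by force
    have s: "u = (x, 0) + dn_scale scale dn_t (y, 0)" by (simp add: u dn_scale_t)
    show "F u = id_plus_t N u"
      using v unfolding s
      by (simp only: module_hom.add[OF F] module_hom.add[OF hom] module_hom.scale[OF F]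
            module_hom.scale[OF hom])
  qed
  show ?thesis unfolding i val[symmetric] using hom uniq by blast
qed

text \<open>The maps \<open>d1\<close>, \<open>d2\<close> do form a complex, so the quotient \<^const>\<open>H2_Nov\<close> makes sense.\<close>

lemma (in novikov_algebra) nprod_simps:
  "x \<diamondop> (y + z) = x \<diamondop> y + x \<diamondop> z" "(y + z) \<diamondop> x = y \<diamondop> x + z \<diamondop> x"
  "x \<diamondop> (y - z) = x \<diamondop> y - x \<diamondop> z" "(y - z) \<diamondop> x = y \<diamondop> x - z \<diamondop> x"
  "x \<diamondop> scale a y = scale a (x \<diamondop> y)" "scale a x \<diamondop> y = scale a (x \<diamondop> y)"
proof -
  have h: "module_hom scale scale ((\<diamondop>) x)" "module_hom scale scale (\<lambda>y. y \<diamondop> x)" for x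
    using bilinear by (simp_all add: bilinear_map_def)
  show "x \<diamondop> (y + z) = x \<diamondop> y + x \<diamondop> z" "x \<diamondop> scale a y = scale a (x \<diamondop> y)"
    "x \<diamondop> (y - z) = x \<diamondop> y - x \<diamondop> z"
    by (fact module_hom.add[OF h(1)] module_hom.scale[OF h(1)] module_hom.diff[OF h(1)])+
  show "(y + z) \<diamondop> x = y \<diamondop> x + z \<diamondop> x" "scale a x \<diamondop> y = scale a (x \<diamondop> y)"
    "(y - z) \<diamondop> x = y \<diamondop> x - z \<diamondop> x"
    by (fact module_hom.add[OF h(2)] module_hom.scale[OF h(2)] module_hom.diff[OF h(2)])+
qed

lemma d1_in_cochains2:
  assumes "novikov_algebra scale nprod" "N \<in> cochains1 scale"
  shows "d1 nprod N \<in> cochains2 scale"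
proof -
  interpret novikov_algebra scale nprod by fact
  interpret N: module_hom scale scale N using assms(2) by (simp add: cochains1_def)
  show ?thesis
    unfolding cochains2_def bilinear_map_def module_hom_iff d1_def
    by (auto simp: module_axioms nprod_simps N.add N.scale algebra_simps)
qed

lemma d2_in_cochains3:
  assumes "novikov_algebra scale nprod" "f \<in> cochains2 scale"
  shows "d2 nprod f \<in> cochains3 scale"
proof -
  interpret novikov_algebra scale nprod by fact
  have f: "f x (y + z) = f x y + f x z" "f (y + z) x = f y x + f z x"
    "f x (scale a y) = scale a (f x y)" "f (scale a x) y = scale a (f x y)" for x y z a
    using assms(2) by (auto simp: cochains2_def bilinear_map_def module_hom_iff)
  show ?thesis
    unfolding cochains3_def bilinear_map_def module_hom_iff d2_def d2_102_def d2_021_def Let_def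
    by (auto simp: module_axioms nprod_simps f algebra_simps)
qed

lemma coboundaries2_subset_cocycles2:
  assumes "novikov_algebra scale nprod"
  shows "coboundaries2 scale nprod \<subseteq> cocycles2 scale nprod"
proof
  interpret novikov_algebra scale nprod by fact
  fix f assume "f \<in> coboundaries2 scale nprod"
  then obtain N where N: "N \<in> cochains1 scale" and f: "f = d1 nprod N"
    by (auto simp: coboundaries2_def)
  interpret N: module_hom scale scale N using N by (simp add: cochains1_def)
  have rc: "nprod (nprod x y) z = nprod (nprod x z) y" for x y z
    by (rule right_commutative)
  define L where
    "L x y z = nprod (nprod x y) z - nprod x (nprod y z) - nprod (nprod y x) z + nprod y (nprod x z)"
    for x y z
  have L: "L x y z = 0" for x y z using left_symmetric[of x y z] by (simp add: L_def algebra_simps)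
  have 1: "d2_102 nprod f x y z = 0" for x y z
    using rc[of "N x" y z] rc[of x "N y" z] rc[of x y "N z"] arg_cong[OF rc[of x y z], of N]
    by (simp add: f d2_102_def d1_def nprod_simps N.add N.diff algebra_simps)
  have "d2_021 nprod f x y z = N (L x y z) - L (N x) y z - L x (N y) z - L x y (N z)" for x y z
    by (simp add: f L_def d2_021_def d1_def nprod_simps N.add N.diff algebra_simps)
  then have 2: "d2_021 nprod f x y z = 0" for x y z by (simp add: L)
  show "f \<in> cocycles2 scale nprod"
    using d1_in_cochains2[OF assms N] 1 2
    by (simp add: cocycles2_def f d2_def zero_prod_def fun_eq_iff)
qed

end

theory Submission
  imports Defs
begin

lemma deformed_prod_Pair [simp]:
  "deformed_prod nprod \<omega> (x0, x1) (y0, y1) = (nprod x0 y0, nprod x0 y1 + nprod x1 y0 + \<omega> x0 y0)"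
  by (simp add: deformed_prod_def)

context novikov_algebra
begin

text \<open>
  The multiples of $t$ in the arguments contribute only instances of the Novikov identities of the
  undeformed product, so the defects of the deformed identities are governed by \<^const>\<open>d2\<close>.
\<close>

lemma deformed_right_commutative_iff:
  "(\<forall>x y z. deformed_prod (\<diamondop>) \<omega> (deformed_prod (\<diamondop>) \<omega> x y) z =
            deformed_prod (\<diamondop>) \<omega> (deformed_prod (\<diamondop>) \<omega> x z) y) \<longleftrightarrow>
   d2_102 (\<diamondop>) \<omega> = 0" (is "(\<forall>x y z. ?P (?P x y) z = ?P (?P x z) y) \<longleftrightarrow> _")
proof -
  \<comment> \<open>The first instance of right commutativity cancels the constant terms. The other
    three, each with one argument replaced by its \<open>t\<close>-part, cancel in the coefficient
    of \<open>t\<close> everything that does not involve \<open>\<omega>\<close>.\<close>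
  have *: "?P (?P (x0, x1) (y0, y1)) (z0, z1) - ?P (?P (x0, x1) (z0, z1)) (y0, y1) =
      (0, - d2_102 (\<diamondop>) \<omega> x0 y0 z0)" for x0 x1 y0 y1 z0 z1
    using right_commutative[of x0 y0 z0] right_commutative[of x1 y0 z0]
      right_commutative[of x0 y1 z0] right_commutative[of x0 y0 z1]
    by (simp add: d2_102_def nprod_simps algebra_simps)
  have "?P (?P (x0, x1) (y0, y1)) (z0, z1) = ?P (?P (x0, x1) (z0, z1)) (y0, y1) \<longleftrightarrow>
      d2_102 (\<diamondop>) \<omega> x0 y0 z0 = 0" for x0 x1 y0 y1 z0 z1
    using *[of x0 x1 y0 y1 z0 z1] by (subst eq_iff_diff_eq_0) (simp only: zero_prod_def, simp)
  then show ?thesis by (simp only: split_paired_All fun_eq_iff zero_fun_def) simp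
qed

lemma deformed_left_symmetric_iff:
  "(\<forall>x y z. deformed_prod (\<diamondop>) \<omega> (deformed_prod (\<diamondop>) \<omega> x y) z -
            deformed_prod (\<diamondop>) \<omega> x (deformed_prod (\<diamondop>) \<omega> y z) =
            deformed_prod (\<diamondop>) \<omega> (deformed_prod (\<diamondop>) \<omega> y x) z -
            deformed_prod (\<diamondop>) \<omega> y (deformed_prod (\<diamondop>) \<omega> x z)) \<longleftrightarrow>
   d2_021 (\<diamondop>) \<omega> = 0"
  (is "(\<forall>x y z. ?P (?P x y) z - ?P x (?P y z) = ?P (?P y x) z - ?P y (?P x z)) \<longleftrightarrow> _")
proof -
  define A where "A x y z = ?P (?P x y) z - ?P x (?P y z)" for x y z
  \<comment> \<open>Keeping the undeformed defect \<open>L\<close> as a named expression makes the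
    next identity a consequence of bilinearity alone; left symmetry enters only afterwards, through
    \<open>L0\<close>.\<close>
  define L where "L x y z = (x \<diamondop> y) \<diamondop> z - x \<diamondop> (y \<diamondop> z) - ((y \<diamondop> x) \<diamondop> z - y \<diamondop> (x \<diamondop> z))" for x y z
  have L0: "L x y z = 0" for x y z using left_symmetric[of x y z] by (simp add: L_def)
  have "A (x0, x1) (y0, y1) (z0, z1) - A (y0, y1) (x0, x1) (z0, z1) =
      (L x0 y0 z0, L x1 y0 z0 + L x0 y1 z0 + L x0 y0 z1 - d2_021 (\<diamondop>) \<omega> x0 y0 z0)"
    for x0 x1 y0 y1 z0 z1
    by (simp add: A_def L_def d2_021_def nprod_simps algebra_simps)
  then have "A (x0, x1) (y0, y1) (z0, z1) = A (y0, y1) (x0, x1) (z0, z1) \<longleftrightarrow>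
      d2_021 (\<diamondop>) \<omega> x0 y0 z0 = 0" for x0 x1 y0 y1 z0 z1
    by (subst eq_iff_diff_eq_0) (simp add: L0 zero_prod_def)
  then show ?thesis
    unfolding A_def[symmetric] by (simp only: split_paired_All fun_eq_iff zero_fun_def) simp
qed

end

text \<open>For bilinear \<open>\<omega>\<close> the module axioms and the bilinearity of the
  deformed product over the dual numbers hold automatically. Only the two Novikov identities remain,
  and they are the vanishing of the two components of \<open>d2\<close>. If \<open>\<omega>\<close>
  is not bilinear, both sides are false by definition.\<close>

lemma generates_infinitesimal_deformation_iff:
  assumes "novikov_algebra scale nprod"
  shows "generates_infinitesimal_deformation scale nprod \<omega> \<longleftrightarrow> \<omega> \<in> cocycles2 scale nprod"
proof (cases "\<omega> \<in> cochains2 scale")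
  case True
  interpret novikov_algebra scale nprod by fact
  have "bilinear_map (dn_scale scale) (dn_scale scale) (dn_scale scale) (deformed_prod nprod \<omega>)"
    using deformed_prod_extension[of scale nprod \<omega> "deformed_prod nprod \<omega>"] bilinear True
    by (simp add: cochains2_def)
  with module_dn_scale[OF module_axioms] True show ?thesis
    unfolding generates_infinitesimal_deformation_def cocycles2_def d2_def
      novikov_algebra_def novikov_algebra_axioms_def
    by (auto simp only: deformed_left_symmetric_iff deformed_right_commutative_iff zero_prod_def
        prod.inject mem_Collect_eq)
qed (simp add: generates_infinitesimal_deformation_def cocycles2_def)

text \<open>Modulo \<open>t^2\<close> the cross term \<open>nprod (N x) (N y)\<close> disappears,
  and the contributions of \<open>x1\<close> and \<open>y1\<close> are the same on both sides. What
  is left to compare is the coefficient of \<open>t\<close> at \<open>x0\<close>,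
  \<open>y0\<close>.\<close>

lemma id_plus_t_multiplicative_iff:
  assumes "novikov_algebra scale nprod"
  shows "(\<forall>x y. id_plus_t N (deformed_prod nprod \<omega> x y) =
                deformed_prod nprod \<omega>' (id_plus_t N x) (id_plus_t N y)) \<longleftrightarrow>
         \<omega> = \<omega>' + d1 nprod N"
proof -
  interpret novikov_algebra scale nprod by fact
  have "id_plus_t N (deformed_prod nprod \<omega> (x0, x1) (y0, y1)) =
        deformed_prod nprod \<omega>' (id_plus_t N (x0, x1)) (id_plus_t N (y0, y1)) \<longleftrightarrow>
        \<omega> x0 y0 = (\<omega>' + d1 nprod N) x0 y0" for x0 x1 y0 y1
    by (auto simp: id_plus_t_def d1_def nprod_simps algebra_simps)
  then show ?thesis by (simp only: split_paired_All fun_eq_iff) simp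
qed

lemma equivalent_deformations_iff:
  assumes "novikov_algebra scale nprod"
    and "generates_infinitesimal_deformation scale nprod \<omega>"
    and "generates_infinitesimal_deformation scale nprod \<omega>'"
  shows "equivalent_deformations scale nprod \<omega> \<omega>' \<longleftrightarrow>
         \<omega> \<in> cohomology_class scale nprod \<omega>'"
proof -
  have "novikov_hom (dn_scale scale) (deformed_prod nprod \<omega>)
          (dn_scale scale) (deformed_prod nprod \<omega>') (id_plus_t N) \<longleftrightarrow>
        \<omega> = \<omega>' + d1 nprod N" if "N \<in> cochains1 scale" for N
    \<comment> \<open>The extension lemma at \<open>id_plus_t N\<close> itself supplies linearity,
      so multiplicativity is the only open condition of \<open>novikov_hom\<close>. Quantifiers over
      pairs must stay unsplit to match the rewrite rule for it.\<close>
    using that assms id_plus_t_extension[of scale N "id_plus_t N"]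
    by (simp add: novikov_hom_def cochains1_def generates_infinitesimal_deformation_def
        id_plus_t_multiplicative_iff[OF assms(1)] del: split_paired_All)
  then show ?thesis
    by (auto simp: equivalent_deformations_def cohomology_class_def coboundaries2_def elt_set_plus_def)
qed

text \<open>These closure properties make the coboundaries an additive subgroup, which is what
  comparing cohomology classes as cosets requires.\<close>

lemma coboundaries2_closed:
  assumes "novikov_algebra scale nprod"
  shows "0 \<in> coboundaries2 scale nprod"
    and "\<lbrakk>f \<in> coboundaries2 scale nprod; g \<in> coboundaries2 scale nprod\<rbrakk>
           \<Longrightarrow> f - g \<in> coboundaries2 scale nprod"
proof -
  interpret novikov_algebra scale nprod by fact
  have diff: "f - g \<in> coboundaries2 scale nprod"
    if fg: "f \<in> coboundaries2 scale nprod" "g \<in> coboundaries2 scale nprod" for f g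
  proof -
    obtain M N where M: "module_hom scale scale M" "f = d1 nprod M"
      and N: "module_hom scale scale N" "g = d1 nprod N"
      using fg unfolding coboundaries2_def cochains1_def by blast
    have "f - g = d1 nprod (\<lambda>x. M x - N x)"
      by (simp add: M N d1_def fun_eq_iff nprod_simps algebra_simps)
    moreover have "module_hom scale scale (\<lambda>x. M x - N x)"
      using M(1) N(1) by (simp add: module_hom_iff scale_right_diff_distrib)
    ultimately show ?thesis by (auto simp: coboundaries2_def cochains1_def)
  qed
  then show "\<lbrakk>f \<in> coboundaries2 scale nprod; g \<in> coboundaries2 scale nprod\<rbrakk>
      \<Longrightarrow> f - g \<in> coboundaries2 scale nprod" .
  \<comment> \<open>Zero is obtained as the difference of a coboundary with itself;
    \<open>id\<close> serves as a linear map that is always at hand.\<close>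
  have "d1 nprod id \<in> coboundaries2 scale nprod"
    by (simp add: coboundaries2_def cochains1_def module_hom_id)
  from diff[OF this this] show "0 \<in> coboundaries2 scale nprod" by simp
qed

lemma cohomology_class_eq_iff:
  assumes "novikov_algebra scale nprod"
  shows "cohomology_class scale nprod f = cohomology_class scale nprod g \<longleftrightarrow>
         f \<in> cohomology_class scale nprod g"
proof -
  note zero = coboundaries2_closed(1)[OF assms] and diff = coboundaries2_closed(2)[OF assms]
  have mem: "f \<in> cohomology_class scale nprod g \<longleftrightarrow> f - g \<in> coboundaries2 scale nprod" for f g
    by (simp add: cohomology_class_def set_minus_plus)
  have "h - f \<in> coboundaries2 scale nprod \<longleftrightarrow> h - g \<in> coboundaries2 scale nprod"
    if "f - g \<in> coboundaries2 scale nprod" for h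
    \<comment> \<open>\<open>h - f\<close> is \<open>(h - g) - (f - g)\<close>, and
      \<open>h - g\<close> is \<open>(h - f) - (0 - (f - g))\<close>, so closure under differences
      suffices both ways.\<close>
    using diff[OF _ that, of "h - g"] diff[OF _ diff[OF zero that], of "h - f"] by auto
  \<comment> \<open>Each \<open>f\<close> lies in its own class, so equality of classes gives
    membership.\<close>
  moreover have "f - f \<in> coboundaries2 scale nprod" using zero by simp
  ultimately show ?thesis unfolding set_eq_iff mem by blast
qed

theorem theorem4p3:
  fixes scale :: "'k::field_char_0 \<Rightarrow> 'g::ab_group_add \<Rightarrow> 'g"
    and nprod :: "'g \<Rightarrow> 'g \<Rightarrow> 'g"
  assumes "novikov_algebra scale nprod"
  shows "(\<forall>\<omega> \<in> cochains2 scale.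
            generates_infinitesimal_deformation scale nprod \<omega> \<longleftrightarrow> \<omega> \<in> cocycles2 scale nprod) \<and>
         (\<forall>\<omega> \<omega>'. generates_infinitesimal_deformation scale nprod \<omega> \<longrightarrow>
                 generates_infinitesimal_deformation scale nprod \<omega>' \<longrightarrow>
            (equivalent_deformations scale nprod \<omega> \<omega>' \<longleftrightarrow>
             cohomology_class scale nprod \<omega> = cohomology_class scale nprod \<omega>'))"
  using generates_infinitesimal_deformation_iff[OF assms] equivalent_deformations_iff[OF assms]
    cohomology_class_eq_iff[OF assms]
  by blast

end
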